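(* Let $\mathcal{B}\subset\mathcal{A}\subset\mathbb{R}^m$ be a convex invariant set for $\partial_tu+\nabla\cdot f(u)=S(u)$ with associated constant $\tau_0>0$, and let $\Psi:\mathcal{B}\to\mathbb{R}$ be a quasiconcave functional. Let $n\ge0$, $i\in\mathcal{V}$, and assume that $1+4\Delta t\,\frac{d_{ii}^{L,n}}{m_i}\ge0$ and $2\Delta t\le\tau_0$. Assume that $U_j^n\in\mathcal{B}$ for all $j\in\mathcal{I}(i)$. Set $$\Psi_i^{\min}:=\min\Big(\Psi\big(U_i^n+2\Delta t\,S(U_i^n)\big),\ \min_{j\in\mathcal{I}(i)}\Psi(\overline{U}_{ij}^n)\Big).$$ Then the low-order update $U_i^{L,n+1}$ is in $\mathcal{B}$ and satisfies $\Psi(U_i^{L,n+1})\ge\Psi_i^{\min}$.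
   Context: Hyperbolic system. $\mathcal{A}\subset\mathbb{R}^m$ is a nonempty admissible set, $f:\mathcal{A}\to\mathbb{R}^{m\times d}$ a flux, $S:\mathcal{A}\to\mathbb{R}^m$ a source. For all $v_L,v_R\in\mathcal{A}$ and every unit vector $n\in\mathbb{R}^d$, the Riemann problem $\partial_t v+\partial_x(f(v)n)=0$, $v(x,0)=v_L$ for $x<0$, $v(x,0)=v_R$ for $x>0$, is assumed to have a unique entropy-satisfying self-similar weak solution $v(n,v_L,v_R,\xi)$, $\xi=x/t$, and a maximum wave speed $\lambda_{\max}(n,v_L,v_R)$ such that this solution equals $v_L$ if $\xi\le-\lambda_{\max}(n,v_L,v_R)$ and $v_R$ if $\xi\ge\lambda_{\max}(n,v_L,v_R)$. The average over the Riemann fan is $\overline{v}(t,n,v_L,v_R):=\int_{-1/2}^{1/2}v(n,v_L,v_R,x/t)\,dx$; recall that if $t\lambda_{\max}(n,v_L,v_R)\le\frac12$ then $\overline{v}(t,n,v_L,v_R)=\frac12(v_L+v_R)-t\,(f(v_R)n-f(v_L)n)$. Invariant set. $\mathcal{B}\subset\mathcal{A}$ is an invariant set if it is convex, if for all $v_L,v_R\in\mathcal{B}$, all unit vectors $n$ and all $t>0$ with $t\lambda_{\max}(n,v_L,v_R)\le\frac12$ one has $\overline{v}(t,n,v_L,v_R)\in\mathcal{B}$, and if there is $\tau_0>0$ such that $U+\tau S(U)\in\mathcal{B}$ for all $U\in\mathcal{B}$ and all $\tau\in[0,\tau_0]$. Low-order (GMS-GV) scheme. $\mathcal{V}$ is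 a finite index set; for each $i\in\mathcal{V}$, $\mathcal{I}(i)\subset\mathcal{V}$ contains $i$, and $j\in\mathcal{I}(i)$ iff $i\in\mathcal{I}(j)$. $m_i>0$; $c_{ij}\in\mathbb{R}^d$ satisfy $c_{ij}=-c_{ji}$ and $\sum_{j\in\mathcal{I}(i)}c_{ij}=0$. $\Delta t>0$ is the time step and $U_i^n\in\mathcal{A}$. With $n_{ij}:=c_{ij}/\|c_{ij}\|_{\ell^2}$, for $j\ne i$, $$d_{ij}^{L,n}:=\max\big(\lambda_{\max}(n_{ij},U_i^n,U_j^n)\|c_{ij}\|_{\ell^2},\ \lambda_{\max}(n_{ji},U_j^n,U_i^n)\|c_{ji}\|_{\ell^2}\big),$$ assumed $>0$ (in particular $c_{ij}\neq0$), and $d_{ii}^{L,n}:=-\sum_{j\in\mathcal{I}(i)\setminus\{i\}}d_{ij}^{L,n}$. The low-order update $U_i^{L,n+1}$ is defined by $$\tfrac{m_i}{\Delta t}(U_i^{L,n+1}-U_i^n)+\sum_{j\in\mathcal{I}(i)}f(U_j^n)c_{ij}-\sum_{j\in\mathcal{I}(i)\setminus\{i\}}d_{ij}^{L,n}(U_j^n-U_i^n)=m_iS(U_i^n).$$ Auxiliary states: $\overline{U}_{ij}^n:=\frac12(U_i^n+U_j^n)-(f(U_j^n)-f(U_i^n))\frac{c_{ij}}{2d_{ij}^{L,n}}$ for $j\ne i$, and $\overline{U}_{ii}^n:=U_i^n$. Quasiconcavity. $\Psi:\mathcal{B}\to\mathbb{R}$ is quasiconcave if $\{U\in\mathcal{B}:\Psi(U)\ge\chi\}$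 is convex for every $\chi\in\mathbb{R}$. *)

theory Defs
  imports "HOL-Analysis.Analysis"
begin

section \<open>Riemann problems for hyperbolic systems\<close>

text \<open>
  Points of the space-time plane are pairs \<open>(x, t)\<close>. A test function is the restriction to
  \<open>t \<ge> 0\<close> of a compactly supported \<open>C\<^sup>1\<close> function \<open>\<phi>\<close> on the plane; \<open>\<phi>x\<close> and \<open>\<phi>t\<close> are its
  partial derivatives. In particular \<open>\<phi>\<close> need not vanish at \<open>t = 0\<close>.
\<close>

definition test_function ::
  "(real \<times> real \<Rightarrow> real) \<Rightarrow> (real \<times> real \<Rightarrow> real) \<Rightarrow> (real \<times> real \<Rightarrow> real) \<Rightarrow> bool" where
  "test_function \<phi> \<phi>x \<phi>t \<longleftrightarrow>
     (\<exists>K. compact K \<and> (\<forall>p. p \<notin> K \<longrightarrow> \<phi> p = 0)) \<and>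
     continuous_on UNIV \<phi>x \<and> continuous_on UNIV \<phi>t \<and>
     (\<forall>p. (\<phi> has_derivative (\<lambda>h. \<phi>x p * fst h + \<phi>t p * snd h)) (at p))"

definition half_plane :: "(real \<times> real) set" where
  "half_plane = UNIV \<times> {0<..}"

text \<open>
  Integrability up to \<open>t = 0\<close> (compact subsets of the closed half plane). Working with \<open>lborel\<close>
  amounts to choosing Borel representatives of the almost-everywhere classes.
\<close>

definition locally_integrable ::
  "(real \<times> real \<Rightarrow> 'b::{banach, second_countable_topology}) \<Rightarrow> bool" where
  "locally_integrable u \<longleftrightarrow>
     (\<forall>K. compact K \<longrightarrow> set_integrable lborel (K \<inter> half_plane) u)"

definition riemann_data :: "'b \<Rightarrow> 'b \<Rightarrow> real \<Rightarrow> 'b" where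
  "riemann_data vL vR x = (if x < 0 then vL else vR)"

text \<open>
  Weak (distributional) solutions on \<open>t > 0\<close> of \<open>\<partial>\<^sub>t u + \<partial>\<^sub>x (g u) = 0\<close>, \<open>u(x,0) = u0 x\<close>,
  with values in \<open>A\<close>.
\<close>

definition weak_solution ::
  "'b::euclidean_space set \<Rightarrow> ('b \<Rightarrow> 'b) \<Rightarrow> (real \<Rightarrow> 'b) \<Rightarrow> (real \<times> real \<Rightarrow> 'b) \<Rightarrow> bool" where
  "weak_solution A g u0 u \<longleftrightarrow>
     (\<forall>p\<in>half_plane. u p \<in> A) \<and>
     locally_integrable u \<and> locally_integrable (\<lambda>p. g (u p)) \<and>
     (\<forall>\<phi> \<phi>x \<phi>t. test_function \<phi> \<phi>x \<phi>t \<longrightarrow>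
        (LINT p:half_plane|lborel. \<phi>t p *\<^sub>R u p + \<phi>x p *\<^sub>R g (u p)) +
        (LINT x|lborel. \<phi> (x, 0) *\<^sub>R u0 x) = 0)"

text \<open>
  Entropy pairs: \<open>\<eta>\<close> is convex and \<open>\<nabla>q\<^sub>k = \<nabla>\<eta> \<sqdot> \<partial>f\<^sub>k\<close> for every column \<open>f\<^sub>k\<close> of the flux. As the
  admissible set is not required to be convex, convexity of \<open>\<eta>\<close> is required on every convex
  subset of it.
\<close>

definition entropy_pair ::
  "(real^'m) set \<Rightarrow> (real^'m \<Rightarrow> real^'d^'m) \<Rightarrow> (real^'m \<Rightarrow> real) \<Rightarrow> (real^'m \<Rightarrow> real^'d) \<Rightarrow> bool" where
  "entropy_pair A f \<eta> q \<longleftrightarrow>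
     (\<forall>C. C \<subseteq> A \<and> convex C \<longrightarrow> convex_on C \<eta>) \<and>
     (\<forall>U\<in>A. \<exists>Df D\<eta>.
        (f has_derivative Df) (at U within A) \<and>
        (\<eta> has_derivative D\<eta>) (at U within A) \<and>
        (q has_derivative (\<lambda>h. \<chi> k. D\<eta> (column k (Df h)))) (at U within A))"

text \<open>
  The weak form of \<open>\<partial>\<^sub>t \<eta>(u) + \<partial>\<^sub>x (q(u) \<bullet> n) \<le> 0\<close> for all entropy pairs in \<open>E\<close>, including the
  initial data.
\<close>

definition entropy_satisfying ::
  "((real^'m \<Rightarrow> real) \<times> (real^'m \<Rightarrow> real^'d)) set \<Rightarrow> real^'d \<Rightarrow> (real \<Rightarrow> real^'m) \<Rightarrow>
   (real \<times> real \<Rightarrow> real^'m) \<Rightarrow> bool" where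
  "entropy_satisfying E n u0 u \<longleftrightarrow>
     (\<forall>(\<eta>, q)\<in>E.
        locally_integrable (\<lambda>p. \<eta> (u p)) \<and> locally_integrable (\<lambda>p. q (u p) \<bullet> n) \<and>
        (\<forall>\<phi> \<phi>x \<phi>t. test_function \<phi> \<phi>x \<phi>t \<and> (\<forall>p. 0 \<le> \<phi> p) \<longrightarrow>
           0 \<le> (LINT p:half_plane|lborel. \<phi>t p * \<eta> (u p) + \<phi>x p * (q (u p) \<bullet> n)) +
               (LINT x|lborel. \<phi> (x, 0) * \<eta> (u0 x))))"

definition riemann_solution ::
  "(real^'m) set \<Rightarrow> (real^'m \<Rightarrow> real^'d^'m) \<Rightarrow>
   ((real^'m \<Rightarrow> real) \<times> (real^'m \<Rightarrow> real^'d)) set \<Rightarrow>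
   real^'d \<Rightarrow> real^'m \<Rightarrow> real^'m \<Rightarrow> (real \<Rightarrow> real^'m) \<Rightarrow> bool" where
  "riemann_solution A f E n vL vR w \<longleftrightarrow>
     weak_solution A (\<lambda>U. f U *v n) (riemann_data vL vR) (\<lambda>(x, t). w (x / t)) \<and>
     entropy_satisfying E n (riemann_data vL vR) (\<lambda>(x, t). w (x / t))"

text \<open>
  The standing assumption on the system: \<open>v n vL vR\<close> is the profile, in \<open>\<xi> = x/t\<close>, of the unique
  entropy-satisfying self-similar weak solution of the Riemann problem, and \<open>lmax n vL vR\<close> is
  a maximum wave speed. Solutions are identified when they agree almost everywhere. The set \<open>E\<close>
  collects the entropy pairs which select the solution; it may be the set of all entropy pairs.
\<close>

definition hyperbolic_system ::
  "(real^'m) set \<Rightarrow> (real^'m \<Rightarrow> real^'d^'m) \<Rightarrow>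
   ((real^'m \<Rightarrow> real) \<times> (real^'m \<Rightarrow> real^'d)) set \<Rightarrow>
   (real^'d \<Rightarrow> real^'m \<Rightarrow> real^'m \<Rightarrow> real \<Rightarrow> real^'m) \<Rightarrow>
   (real^'d \<Rightarrow> real^'m \<Rightarrow> real^'m \<Rightarrow> real) \<Rightarrow> bool" where
  "hyperbolic_system A f E v lmax \<longleftrightarrow>
     A \<noteq> {} \<and>
     (\<forall>(\<eta>, q)\<in>E. entropy_pair A f \<eta> q) \<and>
     (\<forall>vL\<in>A. \<forall>vR\<in>A. \<forall>n. norm n = 1 \<longrightarrow>
        riemann_solution A f E n vL vR (v n vL vR) \<and>
        (\<forall>w. riemann_solution A f E n vL vR w \<longrightarrow> (AE \<xi> in lborel. w \<xi> = v n vL vR \<xi>)) \<and>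
        (\<forall>\<xi>. \<xi> \<le> - lmax n vL vR \<longrightarrow> v n vL vR \<xi> = vL) \<and>
        (\<forall>\<xi>. lmax n vL vR \<le> \<xi> \<longrightarrow> v n vL vR \<xi> = vR))"

definition riemann_average ::
  "(real^'d \<Rightarrow> real^'m \<Rightarrow> real^'m \<Rightarrow> real \<Rightarrow> real^'m) \<Rightarrow>
   real \<Rightarrow> real^'d \<Rightarrow> real^'m \<Rightarrow> real^'m \<Rightarrow> real^'m" where
  "riemann_average v t n vL vR = (LINT x:{-1/2..1/2}|lborel. v n vL vR (x / t))"

definition invariant_set ::
  "(real^'m) set \<Rightarrow> (real^'m \<Rightarrow> real^'m) \<Rightarrow>
   (real^'d \<Rightarrow> real^'m \<Rightarrow> real^'m \<Rightarrow> real \<Rightarrow> real^'m) \<Rightarrow>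
   (real^'d \<Rightarrow> real^'m \<Rightarrow> real^'m \<Rightarrow> real) \<Rightarrow> (real^'m) set \<Rightarrow> real \<Rightarrow> bool" where
  "invariant_set A S v lmax B \<tau>0 \<longleftrightarrow>
     B \<subseteq> A \<and> convex B \<and>
     (\<forall>vL\<in>B. \<forall>vR\<in>B. \<forall>n t. norm n = 1 \<and> 0 < t \<and> t * lmax n vL vR \<le> 1/2 \<longrightarrow>
        riemann_average v t n vL vR \<in> B) \<and>
     0 < \<tau>0 \<and> (\<forall>U\<in>B. \<forall>\<tau>\<in>{0..\<tau>0}. U + \<tau> *\<^sub>R S U \<in> B)"

definition quasiconcave_on :: "'b::real_vector set \<Rightarrow> ('b \<Rightarrow> real) \<Rightarrow> bool" where
  "quasiconcave_on B \<Psi> \<longleftrightarrow> (\<forall>\<kappa>. convex {U \<in> B. \<kappa> \<le> \<Psi> U})"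


section \<open>The low-order scheme\<close>

definition stencil ::
  "'i set \<Rightarrow> ('i \<Rightarrow> 'i set) \<Rightarrow> ('i \<Rightarrow> real) \<Rightarrow> ('i \<Rightarrow> 'i \<Rightarrow> real^'d) \<Rightarrow> bool" where
  "stencil V I m c \<longleftrightarrow>
     finite V \<and>
     (\<forall>i\<in>V. I i \<subseteq> V \<and> i \<in> I i) \<and>
     (\<forall>i\<in>V. \<forall>j\<in>V. j \<in> I i \<longleftrightarrow> i \<in> I j) \<and>
     (\<forall>i\<in>V. 0 < m i) \<and>
     (\<forall>i\<in>V. \<forall>j\<in>I i. c i j = - c j i) \<and>
     (\<forall>i\<in>V. (\<Sum>j\<in>I i. c i j) = 0)"

definition unit_normal :: "('i \<Rightarrow> 'i \<Rightarrow> real^'d) \<Rightarrow> 'i \<Rightarrow> 'i \<Rightarrow> real^'d" where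
  "unit_normal c i j = c i j /\<^sub>R norm (c i j)"

definition viscosity_offdiag ::
  "(real^'d \<Rightarrow> real^'m \<Rightarrow> real^'m \<Rightarrow> real) \<Rightarrow> ('i \<Rightarrow> 'i \<Rightarrow> real^'d) \<Rightarrow> ('i \<Rightarrow> real^'m) \<Rightarrow>
   'i \<Rightarrow> 'i \<Rightarrow> real" where
  "viscosity_offdiag lmax c U i j =
     max (lmax (unit_normal c i j) (U i) (U j) * norm (c i j))
         (lmax (unit_normal c j i) (U j) (U i) * norm (c j i))"

text \<open>The low-order graph viscosity \<open>d\<^sub>i\<^sub>j\<close> at the state \<open>U\<close>.\<close>

definition graph_viscosity ::
  "('i \<Rightarrow> 'i set) \<Rightarrow> (real^'d \<Rightarrow> real^'m \<Rightarrow> real^'m \<Rightarrow> real) \<Rightarrow> ('i \<Rightarrow> 'i \<Rightarrow> real^'d) \<Rightarrow>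
   ('i \<Rightarrow> real^'m) \<Rightarrow> 'i \<Rightarrow> 'i \<Rightarrow> real" where
  "graph_viscosity I lmax c U i j =
     (if j = i then - (\<Sum>k\<in>I i - {i}. viscosity_offdiag lmax c U i k)
      else viscosity_offdiag lmax c U i j)"

text \<open>\<open>UL\<close> is the low-order update of the state \<open>U\<close> with time step \<open>\<Delta>t\<close>.\<close>

definition low_order_update ::
  "'i set \<Rightarrow> ('i \<Rightarrow> 'i set) \<Rightarrow> ('i \<Rightarrow> real) \<Rightarrow> ('i \<Rightarrow> 'i \<Rightarrow> real^'d) \<Rightarrow>
   (real^'m \<Rightarrow> real^'d^'m) \<Rightarrow> (real^'m \<Rightarrow> real^'m) \<Rightarrow>
   (real^'d \<Rightarrow> real^'m \<Rightarrow> real^'m \<Rightarrow> real) \<Rightarrow> real \<Rightarrow>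
   ('i \<Rightarrow> real^'m) \<Rightarrow> ('i \<Rightarrow> real^'m) \<Rightarrow> bool" where
  "low_order_update V I m c f S lmax \<Delta>t U UL \<longleftrightarrow>
     (\<forall>i\<in>V. (m i / \<Delta>t) *\<^sub>R (UL i - U i) + (\<Sum>j\<in>I i. f (U j) *v c i j)
        - (\<Sum>j\<in>I i - {i}. graph_viscosity I lmax c U i j *\<^sub>R (U j - U i)) = m i *\<^sub>R S (U i))"

definition auxiliary_state ::
  "('i \<Rightarrow> 'i set) \<Rightarrow> (real^'d \<Rightarrow> real^'m \<Rightarrow> real^'m \<Rightarrow> real) \<Rightarrow> ('i \<Rightarrow> 'i \<Rightarrow> real^'d) \<Rightarrow>
   (real^'m \<Rightarrow> real^'d^'m) \<Rightarrow> ('i \<Rightarrow> real^'m) \<Rightarrow> 'i \<Rightarrow> 'i \<Rightarrow> real^'m" where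
  "auxiliary_state I lmax c f U i j =
     (if j = i then U i
      else (1/2) *\<^sub>R (U i + U j)
           - (f (U j) - f (U i)) *v (c i j /\<^sub>R (2 * graph_viscosity I lmax c U i j)))"

end

theory Submission
  imports Defs
begin

text \<open>
  The conservation property of the stencil allows the flux at the node \<open>i\<close> to be subtracted in every term of the flux sum, so the update groups into pairs \<open>(i, j)\<close>, and each
  pair contributes an auxiliary state. Splitting \<open>U\<^sub>i\<close> in two halves, one of which absorbs the
  source, gives
  \<open>U\<^sub>i\<^sup>L = (1/2) (U\<^sub>i + 2 \<Delta>t S(U\<^sub>i)) + (1/2) Z\<close>,
  where \<open>Z\<close> combines the auxiliary states with the weights \<open>1 + 4 \<Delta>t d\<^sub>i\<^sub>i / m\<^sub>i\<close> for \<open>j = i\<close> and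
  \<open>4 \<Delta>t d\<^sub>i\<^sub>j / m\<^sub>i\<close> otherwise (lemma \<open>low_order_update_convex_combination\<close>). These weights sum to one
  because \<open>d\<^sub>i\<^sub>i\<close> is minus the sum of the other \<open>d\<^sub>i\<^sub>j\<close>, and the time step restriction makes the
  diagonal one nonnegative. The source half stays in \<open>B\<close> because \<open>2 \<Delta>t \<le> \<tau>\<^sub>0\<close>. A superlevel set of \<open>\<Psi>\<close> in \<open>B\<close> is convex,
  so it contains the update as soon as it contains the states that are combined.

  What remains is that the auxiliary states lie in \<open>B\<close>. Each of them is an average over a Riemann
  fan, at the time \<open>t = |c\<^sub>i\<^sub>j| / (2 d\<^sub>i\<^sub>j)\<close>; the definition of \<open>d\<^sub>i\<^sub>j\<close> is exactly what keeps the waves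
  inside the unit cell until then. This identification needs the formula for the average
  (lemma \<open>riemann_average_eq\<close>), which is the integral balance of the conservation law over a cell.
  Solutions being understood in the weak sense, the balance is obtained by testing with a product
  \<open>\<alpha>(x) \<beta>(t)\<close>, where \<open>\<alpha>\<close> equals one on the whole fan at all positive times in the support of \<open>\<beta>\<close>: the
  flux term then only sees the two constant outer states, and self-similarity turns the remaining term into a
  multiple of the integral of the profile minus the initial data
  (lemma \<open>has_bochner_integral_self_similar_deviation\<close>).
\<close>

section \<open>Plateau functions as test functions\<close>

text \<open>
  For \<open>R \<ge> 0\<close>, a \<open>C\<^sup>1\<close> function which is one on \<open>[-R, R]\<close> and zero off \<open>[-R-1, R+1]\<close>, together with its derivative.
  Squares of positive parts make it \<open>C\<^sup>1\<close> across the four junction points without any case distinction.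
\<close>

definition cutoff :: "real \<Rightarrow> real \<Rightarrow> real" where
  "cutoff R x = (max 0 (1 - (max 0 (x - R))\<^sup>2 - (max 0 (- x - R))\<^sup>2))\<^sup>2"

definition cutoff_deriv :: "real \<Rightarrow> real \<Rightarrow> real" where
  "cutoff_deriv R x = 2 * max 0 (1 - (max 0 (x - R))\<^sup>2 - (max 0 (- x - R))\<^sup>2) *
     (2 * max 0 (- x - R) - 2 * max 0 (x - R))"

lemma DERIV_pos_part_square: "((\<lambda>x::real. (max 0 x)\<^sup>2) has_real_derivative 2 * max 0 x) (at x)"
proof -
  consider "x < 0" | "x = 0" | "0 < x" by linarith
  then show ?thesis
  proof cases
    case 1
    have "((\<lambda>x::real. 0) has_real_derivative 2 * max 0 x) (at x)"
      using 1 by simp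
    moreover have "\<forall>\<^sub>F y in nhds x. (0::real) = (max 0 y)\<^sup>2"
      using eventually_nhds_in_open[of "{..<0}" x] 1 by (auto elim!: eventually_mono)
    ultimately show ?thesis
      by (subst DERIV_cong_ev[OF refl _ refl, where g = "\<lambda>x::real. 0"]) (auto elim: eventually_mono)
  next
    case 3
    have "((\<lambda>x::real. x\<^sup>2) has_real_derivative 2 * max 0 x) (at x)"
      using 3 by (auto intro!: derivative_eq_intros)
    moreover have "\<forall>\<^sub>F y in nhds x. y\<^sup>2 = (max 0 y)\<^sup>2"
      using eventually_nhds_in_open[of "{0<..}" x] 3 by (auto elim!: eventually_mono)
    ultimately show ?thesis
      by (subst DERIV_cong_ev[OF refl _ refl, where g = "\<lambda>x::real. x\<^sup>2"]) (auto elim: eventually_mono)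
  next
    case 2
    have "((\<lambda>h::real. max 0 h) \<longlongrightarrow> max 0 0) (at 0)"
      by (intro tendsto_intros)
    moreover have "\<forall>\<^sub>F h::real in at 0. max 0 h = ((max 0 (0 + h))\<^sup>2 - (max 0 0)\<^sup>2) / h"
      by (intro eventually_at_filter[THEN iffD2] always_eventually) (auto simp: max_def power2_eq_square)
    ultimately show ?thesis
      unfolding 2 DERIV_def using tendsto_cong by fastforce
  qed
qed

lemma DERIV_cutoff: "(cutoff R has_real_derivative cutoff_deriv R x) (at x)"
  unfolding cutoff_def cutoff_deriv_def
  by (rule derivative_eq_intros DERIV_chain2[OF DERIV_pos_part_square] | simp)+

lemma continuous_on_cutoff [continuous_intros]:
  assumes "continuous_on X h"
  shows "continuous_on X (\<lambda>x. cutoff R (h x))" "continuous_on X (\<lambda>x. cutoff_deriv R (h x))"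
  unfolding cutoff_def cutoff_deriv_def by (intro continuous_intros assms)+

lemma cutoff_plateau: "\<bar>x\<bar> \<le> R \<Longrightarrow> cutoff R x = 1" "\<bar>x\<bar> \<le> R \<Longrightarrow> cutoff_deriv R x = 0"
  by (simp_all add: cutoff_def cutoff_deriv_def max_absorb1 abs_le_iff)

lemma cutoff_support:
  assumes "0 \<le> R" "R + 1 \<le> \<bar>x\<bar>"
  shows "cutoff R x = 0" "cutoff_deriv R x = 0"
proof -
  have "1 \<le> (max 0 (x - R))\<^sup>2 + (max 0 (- x - R))\<^sup>2"
  proof (cases "0 \<le> x")
    case True
    then have "1 \<le> (x - R)\<^sup>2" using assms by (intro one_le_power) auto
    then show ?thesis using assms True by (simp add: max_def)
  next
    case False
    then have "1 \<le> (- x - R)\<^sup>2" using assms by (intro one_le_power) auto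
    then show ?thesis using assms False by (simp add: max_def)
  qed
  then have "max 0 (1 - (max 0 (x - R))\<^sup>2 - (max 0 (- x - R))\<^sup>2) = 0"
    by (intro max_absorb1) linarith
  then show "cutoff R x = 0" "cutoff_deriv R x = 0"
    by (simp_all only: cutoff_def cutoff_deriv_def) simp_all
qed

lemma cutoff_product_support:
  assumes "0 \<le> R" "0 \<le> T" "p \<notin> {-(R+1)..R+1} \<times> {-(T+1)..T+1}"
  shows "cutoff R (fst p) * cutoff T (snd p) = 0" "cutoff_deriv R (fst p) * cutoff T (snd p) = 0"
    "cutoff R (fst p) * cutoff_deriv T (snd p) = 0"
proof -
  have "R + 1 \<le> \<bar>fst p\<bar> \<or> T + 1 \<le> \<bar>snd p\<bar>"
    using assms(3) by (cases p) auto
  then show "cutoff R (fst p) * cutoff T (snd p) = 0" "cutoff_deriv R (fst p) * cutoff T (snd p) = 0"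
    "cutoff R (fst p) * cutoff_deriv T (snd p) = 0"
    using assms(1,2) by (auto simp: cutoff_support)
qed

lemma test_function_cutoff:
  assumes "0 \<le> R" "0 \<le> T"
  shows "test_function (\<lambda>p. cutoff R (fst p) * cutoff T (snd p))
    (\<lambda>p. cutoff_deriv R (fst p) * cutoff T (snd p))
    (\<lambda>p. cutoff R (fst p) * cutoff_deriv T (snd p))"
  unfolding test_function_def
proof (intro conjI allI exI[of _ "{-(R+1)..R+1} \<times> {-(T+1)..T+1}"])
  show "compact ({-(R+1)..R+1} \<times> {-(T+1)..T+1})"
    by (intro compact_Times compact_Icc)
next
  fix p :: "real \<times> real"
  show "p \<notin> {-(R+1)..R+1} \<times> {-(T+1)..T+1} \<longrightarrow> cutoff R (fst p) * cutoff T (snd p) = 0"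
    using cutoff_product_support(1)[OF assms] by blast
next
  show "continuous_on UNIV (\<lambda>p. cutoff_deriv R (fst p) * cutoff T (snd p))"
    "continuous_on UNIV (\<lambda>p. cutoff R (fst p) * cutoff_deriv T (snd p))"
    by (intro continuous_intros)+
next
  fix p :: "real \<times> real"
  have *: "((\<lambda>p. cutoff R (fst p)) has_derivative (\<lambda>h. cutoff_deriv R (fst p) * fst h)) (at p)"
    by (rule has_derivative_compose[OF has_derivative_fst[OF has_derivative_ident]
          DERIV_cutoff[unfolded has_field_derivative_def]])
  have **: "((\<lambda>p. cutoff T (snd p)) has_derivative (\<lambda>h. cutoff_deriv T (snd p) * snd h)) (at p)"
    by (rule has_derivative_compose[OF has_derivative_snd[OF has_derivative_ident]
          DERIV_cutoff[unfolded has_field_derivative_def]])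
  show "((\<lambda>p. cutoff R (fst p) * cutoff T (snd p)) has_derivative
     (\<lambda>h. cutoff_deriv R (fst p) * cutoff T (snd p) * fst h +
          cutoff R (fst p) * cutoff_deriv T (snd p) * snd h)) (at p)"
    by (rule has_derivative_eq_rhs[OF has_derivative_mult[OF * **]]) (auto simp: algebra_simps)
qed

text \<open>
  On \<open>[0, 1]\<close> the cutoff with plateau \<open>{0}\<close> is \<open>(1 - t\<^sup>2)\<^sup>2\<close>. All that matters below is that its
  integral does not vanish, so that it can be cancelled.
\<close>

lemma integral_cutoff_0: "(LINT t:{0..1}|lborel. cutoff 0 t) = 8 / 15"
proof -
  have "(\<integral>t. (1 - t\<^sup>2)\<^sup>2 * indicator {0..1} t \<partial>lborel) =
      (1 - 2 / 3 * 1 ^ 3 + 1 ^ 5 / 5) - (0 - 2 / 3 * 0 ^ 3 + 0 ^ 5 / 5 :: real)"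
    by (rule integral_FTC_Icc_real)
      (auto intro!: derivative_eq_intros simp: power2_eq_square algebra_simps eval_nat_numeral)
  moreover have "(\<lambda>t. indicator {0..1} t *\<^sub>R cutoff 0 t) = (\<lambda>t::real. (1 - t\<^sup>2)\<^sup>2 * indicator {0..1} t)"
  proof
    fix t :: real
    show "indicator {0..1} t *\<^sub>R cutoff 0 t = (1 - t\<^sup>2)\<^sup>2 * indicator {0..1} t"
      by (cases "t \<in> {0..1}") (auto simp: cutoff_def max_absorb1 max_absorb2 power_le_one)
  qed
  ultimately show ?thesis
    by (simp add: set_lebesgue_integral_def)
qed

lemma integrable_compact_support:
  fixes h :: "real \<Rightarrow> real"
  assumes "continuous_on UNIV h" "\<And>x. S \<le> \<bar>x\<bar> \<Longrightarrow> h x = 0"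
  shows "integrable lborel h"
proof -
  have "integrable lborel (\<lambda>x. indicator {-S..S} x *\<^sub>R h x)"
    using assms by (intro borel_integrable_compact) (auto intro: continuous_on_subset)
  also have "(\<lambda>x. indicator {-S..S} x *\<^sub>R h x) = h"
  proof
    fix x
    show "indicator {-S..S} x *\<^sub>R h x = h x"
      using assms(2)[of x] by (cases "S \<le> \<bar>x\<bar>") (auto simp: indicator_def abs_less_iff not_le)
  qed
  finally show ?thesis .
qed

lemma integral_cutoff_deriv:
  assumes "0 \<le> R"
  shows "(LINT x:{..<0}|lborel. cutoff_deriv R x) = 1" "(LINT x:{0..}|lborel. cutoff_deriv R x) = - 1"
proof -
  have supp: "cutoff_deriv R x = 0 \<or> - (R + 1) \<le> x \<and> x \<le> R + 1" for x
    using cutoff_support(2)[of R x] assms by linarith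
  have FTC: "(\<integral>x. indicator {a..b} x *\<^sub>R cutoff_deriv R x \<partial>lborel) = cutoff R b - cutoff R a"
    if "a \<le> b" for a b
    using that DERIV_cutoff[of R]
    by (intro integral_FTC_Icc)
      (auto simp: has_real_derivative_iff_has_vector_derivative intro!: continuous_intros
        intro: has_vector_derivative_at_within)
  have "(LINT x:{..<0}|lborel. cutoff_deriv R x) =
      (\<integral>x. indicator {-(R + 1)..0} x *\<^sub>R cutoff_deriv R x \<partial>lborel)"
    unfolding set_lebesgue_integral_def
  proof (rule integral_discrete_difference[of "{0}"])
    fix x :: real
    assume "x \<notin> {0}"
    then show "indicator {..<0} x *\<^sub>R cutoff_deriv R x = indicator {-(R + 1)..0} x *\<^sub>R cutoff_deriv R x"
      using supp[of x] by (auto simp: indicator_def)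
  qed auto
  then show "(LINT x:{..<0}|lborel. cutoff_deriv R x) = 1"
    using FTC[of "-(R + 1)" 0] assms by (simp add: cutoff_plateau cutoff_support)
  have "(LINT x:{0..}|lborel. cutoff_deriv R x) =
      (\<integral>x. indicator {0..R + 1} x *\<^sub>R cutoff_deriv R x \<partial>lborel)"
    unfolding set_lebesgue_integral_def
  proof (rule Bochner_Integration.integral_cong)
    fix x :: real
    show "indicator {0..} x *\<^sub>R cutoff_deriv R x = indicator {0..R + 1} x *\<^sub>R cutoff_deriv R x"
      using supp[of x] by (auto simp: indicator_def)
  qed auto
  then show "(LINT x:{0..}|lborel. cutoff_deriv R x) = - 1"
    using FTC[of 0 "R + 1"] assms by (simp add: cutoff_plateau cutoff_support)
qed

lemma has_bochner_integral_riemann_data: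
  fixes vL vR :: "'b::euclidean_space"
  assumes "integrable lborel h"
  shows "has_bochner_integral lborel (\<lambda>x. h x *\<^sub>R riemann_data vL vR x)
    ((LINT x:{..<0}|lborel. h x) *\<^sub>R vL + (LINT x:{0..}|lborel. h x) *\<^sub>R vR)"
proof -
  have "has_bochner_integral lborel
      (\<lambda>x. (indicator {..<0} x *\<^sub>R h x) *\<^sub>R vL + (indicator {0..} x *\<^sub>R h x) *\<^sub>R vR)
      ((LINT x:{..<0}|lborel. h x) *\<^sub>R vL + (LINT x:{0..}|lborel. h x) *\<^sub>R vR)"
    unfolding set_lebesgue_integral_def
    using assms by (intro has_bochner_integral_add has_bochner_integral_scaleR_left
        has_bochner_integral_integrable integrable_mult_indicator) auto
  also have "(\<lambda>x. (indicator {..<0} x *\<^sub>R h x) *\<^sub>R vL + (indicator {0..} x *\<^sub>R h x) *\<^sub>R vR) =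
      (\<lambda>x. h x *\<^sub>R riemann_data vL vR x)"
    by (auto simp: riemann_data_def fun_eq_iff)
  finally show ?thesis .
qed

lemma has_bochner_integral_riemann_data_Icc:
  fixes vL vR :: "'b::euclidean_space"
  assumes "0 \<le> R"
  shows "has_bochner_integral lborel (\<lambda>x. indicator {-R..R} x *\<^sub>R riemann_data vL vR x)
    (R *\<^sub>R (vL + vR))"
proof -
  have "{..<0} \<inter> {-R..R} = {-R..<0}" "{0..} \<inter> {-R..R} = {0..R}"
    using assms by auto
  then have "(LINT x:{..<0}|lborel. indicator {-R..R} x) = R"
    "(LINT x:{0..}|lborel. indicator {-R..R} x) = R"
    using assms by (simp_all add: set_lebesgue_integral_def flip: indicator_inter_arith)
  then show ?thesis
    using has_bochner_integral_riemann_data[of "indicator {-R..R}" vL vR] assms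
    by (simp add: scaleR_add_right integrable_indicator_iff)
qed

text \<open>
  Almost every time slice of a locally integrable function is integrable. For a self-similar function
  one slice at a time \<open>0 < t < 1\<close> is enough: rescaled, it controls the profile on \<open>[-R/t, R/t]\<close>, hence on
  \<open>[-R, R]\<close>, and outside of this interval the profile coincides with the Riemann data.
\<close>

lemma self_similar_deviation_integrable:
  fixes w :: "real \<Rightarrow> 'b::euclidean_space"
  assumes loc: "locally_integrable (\<lambda>(x, t). w (x / t))" and "0 < R"
    and left: "\<And>\<xi>. \<xi> \<le> - R \<Longrightarrow> w \<xi> = vL" and right: "\<And>\<xi>. R \<le> \<xi> \<Longrightarrow> w \<xi> = vR"
  shows "integrable lborel (\<lambda>\<xi>. w \<xi> - riemann_data vL vR \<xi>)"
proof -
  let ?K = "{-R..R} \<times> {0..1} :: (real \<times> real) set"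
  have "compact ?K"
    by (intro compact_Times compact_Icc)
  then have "integrable (lborel \<Otimes>\<^sub>M lborel)
      (\<lambda>(x, t). indicator (?K \<inter> half_plane) (x, t) *\<^sub>R w (x / t))"
    using loc unfolding locally_integrable_def set_integrable_def lborel_prod
    by (simp add: case_prod_unfold)
  then have slices: "AE t in lborel. integrable lborel
      (\<lambda>x. indicator (?K \<inter> half_plane) (x, t) *\<^sub>R w (x / t))"
    by (rule lborel_pair.AE_integrable_snd)
  \<comment> \<open>A set of full measure meets the unit interval.\<close>
  obtain t where t: "0 < t" "t < 1"
    and int: "integrable lborel (\<lambda>x. indicator (?K \<inter> half_plane) (x, t) *\<^sub>R w (x / t))"
  proof (rule ccontr)
    assume "\<not> thesis"
    then have "AE t::real in lborel. \<not> t \<in> {0<..<1}"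
      using slices that by (auto elim!: eventually_mono)
    then have "emeasure lborel {t \<in> space lborel. t \<in> {0<..<1::real}} = 0"
      by (rule emeasure_eq_0_AE)
    moreover have "{t \<in> space lborel. t \<in> {0<..<1::real}} = {0<..<1}"
      by auto
    ultimately show False by simp
  qed
  have "integrable lborel (\<lambda>\<xi>. indicator {-R..R} \<xi> *\<^sub>R
      (indicator (?K \<inter> half_plane) (0 + t * \<xi>, t) *\<^sub>R w ((0 + t * \<xi>) / t)))"
    using t by (intro integrable_mult_indicator lborel_integrable_real_affine[OF int]) auto
  also have "(\<lambda>\<xi>. indicator {-R..R} \<xi> *\<^sub>R
      (indicator (?K \<inter> half_plane) (0 + t * \<xi>, t) *\<^sub>R w ((0 + t * \<xi>) / t))) =
      (\<lambda>\<xi>. indicator {-R..R} \<xi> *\<^sub>R w \<xi>)"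
  proof
    fix \<xi>
    have "t * \<xi> \<in> {-R..R}" if "\<xi> \<in> {-R..R}"
    proof -
      have "\<bar>t * \<xi>\<bar> \<le> 1 * R"
        unfolding abs_mult using t that by (intro mult_mono) auto
      then show ?thesis by (simp add: abs_le_iff)
    qed
    then show "indicator {-R..R} \<xi> *\<^sub>R
        (indicator (?K \<inter> half_plane) (0 + t * \<xi>, t) *\<^sub>R w ((0 + t * \<xi>) / t)) =
        indicator {-R..R} \<xi> *\<^sub>R w \<xi>"
      using t by (auto simp: half_plane_def split: split_indicator)
  qed
  finally have "integrable lborel (\<lambda>\<xi>. indicator {-R..R} \<xi> *\<^sub>R w \<xi>)" .
  moreover have "integrable lborel (\<lambda>\<xi>. indicator {-R..R} \<xi> *\<^sub>R riemann_data vL vR \<xi>)"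
    using has_bochner_integral_riemann_data_Icc[of R vL vR] \<open>0 < R\<close>
    by (auto simp: has_bochner_integral_iff)
  ultimately have "integrable lborel
      (\<lambda>\<xi>. indicator {-R..R} \<xi> *\<^sub>R w \<xi> - indicator {-R..R} \<xi> *\<^sub>R riemann_data vL vR \<xi>)"
    by (rule Bochner_Integration.integrable_diff)
  also have "(\<lambda>\<xi>. indicator {-R..R} \<xi> *\<^sub>R w \<xi> - indicator {-R..R} \<xi> *\<^sub>R riemann_data vL vR \<xi>) =
      (\<lambda>\<xi>. w \<xi> - riemann_data vL vR \<xi>)"
    using \<open>0 < R\<close> left right by (auto simp: fun_eq_iff riemann_data_def split: split_indicator)
  finally show ?thesis .
qed

lemma locally_integrable_scaleR_compact_support:
  fixes u :: "real \<times> real \<Rightarrow> 'b::euclidean_space" and \<psi> :: "real \<times> real \<Rightarrow> real"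
  assumes "locally_integrable u" and cont: "continuous_on UNIV \<psi>" and K: "compact K"
    and supp: "\<And>p. p \<notin> K \<Longrightarrow> \<psi> p = 0"
  shows "set_integrable lborel half_plane (\<lambda>p. \<psi> p *\<^sub>R u p)"
proof -
  have "bounded (\<psi> ` K)"
    using K cont by (intro compact_imp_bounded compact_continuous_image) (auto intro: continuous_on_subset)
  then obtain C where C: "0 < C" "\<And>p. p \<in> K \<Longrightarrow> \<bar>\<psi> p\<bar> \<le> C"
    unfolding bounded_pos by (metis imageI real_norm_def)
  let ?u = "\<lambda>p. indicator (K \<inter> half_plane) p *\<^sub>R u p"
  have int: "integrable lborel ?u"
    using assms by (auto simp: locally_integrable_def set_integrable_def)
  have [measurable]: "\<psi> \<in> borel_measurable lborel"
    using cont by (simp add: borel_measurable_continuous_onI)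
  have "integrable lborel (\<lambda>p. \<psi> p *\<^sub>R ?u p)"
  proof (rule Bochner_Integration.integrable_bound[OF integrable_scaleR_right[OF int, of C]])
    show "(\<lambda>p. \<psi> p *\<^sub>R ?u p) \<in> borel_measurable lborel"
      using borel_measurable_integrable[OF int] by measurable
    have "norm (\<psi> p *\<^sub>R ?u p) \<le> norm (C *\<^sub>R ?u p)" for p
      using C(1) C(2)[of p] by (auto simp: indicator_def intro!: mult_right_mono)
    then show "AE p in lborel. norm (\<psi> p *\<^sub>R ?u p) \<le> norm (C *\<^sub>R ?u p)"
      by simp
  qed
  also have "(\<lambda>p. \<psi> p *\<^sub>R ?u p) = (\<lambda>p. indicator half_plane p *\<^sub>R \<psi> p *\<^sub>R u p)"
    using supp by (auto simp: fun_eq_iff indicator_def)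
  finally show ?thesis
    by (simp add: set_integrable_def)
qed

section \<open>Averages over Riemann fans\<close>

text \<open>
  The integral balance of a Riemann problem. Let \<open>e\<close> be the profile minus the initial data, \<open>D\<close> its
  integral, and \<open>\<alpha>\<close>, \<open>\<beta>\<close> the cutoffs with plateaus \<open>[-R, R]\<close> and \<open>{0}\<close>. While \<open>0 < t \<le> 1\<close>, the fan lies in the
  plateau of \<open>\<alpha>\<close>. Hence the slice at \<open>t\<close> of the weak formulation tested with \<open>\<alpha>(x) \<beta>(t)\<close> is
  \<open>\<beta>'(t) P + t \<beta>'(t) D + \<beta>(t) (g vL - g vR)\<close>: here \<open>P\<close> is the integral of \<open>\<alpha>\<close> times the data, the
  factor \<open>t\<close> comes from the dilation of \<open>e\<close>, and \<open>\<alpha>'\<close> has integral \<open>1\<close> on the left and \<open>-1\<close> on the right.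
  Integration in time, by parts in the first two terms, turns this into
  \<open>- P - b D + b (g vL - g vR)\<close> with \<open>b\<close> the integral of \<open>\<beta>\<close> over \<open>[0, 1]\<close>. The initial term of the weak
  formulation cancels \<open>P\<close>, and division by \<open>b\<close> gives \<open>D = g vL - g vR\<close>.
\<close>

lemma has_bochner_integral_self_similar_deviation:
  fixes w :: "real \<Rightarrow> 'b::euclidean_space"
  assumes weak: "weak_solution A g (riemann_data vL vR) (\<lambda>(x, t). w (x / t))" and "0 < R"
    and left: "\<And>\<xi>. \<xi> \<le> - R \<Longrightarrow> w \<xi> = vL" and right: "\<And>\<xi>. R \<le> \<xi> \<Longrightarrow> w \<xi> = vR"
  shows "has_bochner_integral lborel (\<lambda>\<xi>. w \<xi> - riemann_data vL vR \<xi>) (g vL - g vR)"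
proof -
  define u0 where "u0 = riemann_data vL vR"
  define e where "e = (\<lambda>\<xi>. w \<xi> - u0 \<xi>)"
  define D where "D = integral\<^sup>L lborel e"
  define P where "P = (\<integral>x. cutoff R x *\<^sub>R u0 x \<partial>lborel)"
  have loc: "locally_integrable (\<lambda>(x, t). w (x / t))" "locally_integrable (\<lambda>(x, t). g (w (x / t)))"
    using weak by (auto simp: weak_solution_def case_prod_unfold)
  have e: "has_bochner_integral lborel e D"
    unfolding e_def D_def u0_def
    by (intro has_bochner_integral_integrable self_similar_deviation_integrable[OF loc(1) \<open>0 < R\<close> left right])
  have "integrable lborel (cutoff R)"
    using \<open>0 < R\<close> by (intro integrable_compact_support[of _ "R + 1"] continuous_intros cutoff_support) auto
  then have P: "has_bochner_integral lborel (\<lambda>x. cutoff R x *\<^sub>R u0 x) P"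
    using has_bochner_integral_riemann_data[of "cutoff R" vL vR]
    by (simp add: u0_def P_def has_bochner_integral_iff)
  have "integrable lborel (cutoff_deriv R)"
    using \<open>0 < R\<close> by (intro integrable_compact_support[of _ "R + 1"] continuous_intros cutoff_support) auto
  then have Q: "has_bochner_integral lborel (\<lambda>x. cutoff_deriv R x *\<^sub>R g (u0 x)) (g vL - g vR)"
    using has_bochner_integral_riemann_data[of "cutoff_deriv R" "g vL" "g vR"] \<open>0 < R\<close>
    by (simp add: u0_def integral_cutoff_deriv riemann_data_def if_distrib[of g])

  define F where "F = (\<lambda>x t. (cutoff R x * cutoff_deriv 0 t) *\<^sub>R w (x / t) +
      (cutoff_deriv R x * cutoff 0 t) *\<^sub>R g (w (x / t)))"
  have slice: "has_bochner_integral lborel (\<lambda>x. F x t)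
      (cutoff_deriv 0 t *\<^sub>R P + (t * cutoff_deriv 0 t) *\<^sub>R D + cutoff 0 t *\<^sub>R (g vL - g vR))"
    if t: "0 < t" "t \<le> 1" for t
  proof -
    have "has_bochner_integral lborel (\<lambda>x. e (0 + (1 / t) * x)) (D /\<^sub>R \<bar>1 / t\<bar>)"
      using e t by (subst lborel_has_bochner_integral_real_affine_iff[symmetric]) auto
    then have e_t: "has_bochner_integral lborel (\<lambda>x. e (x / t)) (t *\<^sub>R D)"
      using t by simp
    have "has_bochner_integral lborel
        (\<lambda>x. cutoff_deriv 0 t *\<^sub>R (cutoff R x *\<^sub>R u0 x) + cutoff_deriv 0 t *\<^sub>R e (x / t) +
          cutoff 0 t *\<^sub>R (cutoff_deriv R x *\<^sub>R g (u0 x)))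
        (cutoff_deriv 0 t *\<^sub>R P + cutoff_deriv 0 t *\<^sub>R (t *\<^sub>R D) + cutoff 0 t *\<^sub>R (g vL - g vR))"
      by (intro has_bochner_integral_add has_bochner_integral_scaleR_right P Q e_t)
    moreover have "F x t = cutoff_deriv 0 t *\<^sub>R (cutoff R x *\<^sub>R u0 x) + cutoff_deriv 0 t *\<^sub>R e (x / t) +
          cutoff 0 t *\<^sub>R (cutoff_deriv R x *\<^sub>R g (u0 x))" for x
    proof -
      have u0_t: "u0 (x / t) = u0 x"
        using t by (simp add: u0_def riemann_data_def divide_less_0_iff)
      show ?thesis
      proof (cases "\<bar>x\<bar> \<le> R")
        case True
        then show ?thesis
          using u0_t by (simp add: F_def e_def cutoff_plateau algebra_simps)
      next
        case False
        have "t * R \<le> R"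
          using t \<open>0 < R\<close> by (simp add: mult_left_le_one_le)
        then have "t * R \<le> \<bar>x\<bar>"
          using False by simp
        then consider "x / t \<le> - R" "x < 0" | "R \<le> x / t" "0 < x"
          using t False \<open>0 < R\<close> by (cases "x < 0") (auto simp: field_simps)
        then have "w (x / t) = u0 x"
          by cases (simp_all add: left right u0_def riemann_data_def)
        then show ?thesis
          using u0_t by (simp add: F_def e_def mult.commute)
      qed
    qed
    ultimately show ?thesis
      by (simp add: mult.commute)
  qed

  have int: "integrable (lborel \<Otimes>\<^sub>M lborel) (\<lambda>(x, t). indicator half_plane (x, t) *\<^sub>R F x t)"
  proof -
    have K: "compact ({-(R+1)..R+1} \<times> {-(0+1)..0+1} :: (real \<times> real) set)"
      by (intro compact_Times compact_Icc)
    have "set_integrable lborel half_plane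
        (\<lambda>p. (cutoff R (fst p) * cutoff_deriv 0 (snd p)) *\<^sub>R (\<lambda>(x, t). w (x / t)) p)"
      using \<open>0 < R\<close> by (intro locally_integrable_scaleR_compact_support[OF loc(1) _ K] continuous_intros
          cutoff_product_support) auto
    moreover have "set_integrable lborel half_plane
        (\<lambda>p. (cutoff_deriv R (fst p) * cutoff 0 (snd p)) *\<^sub>R (\<lambda>(x, t). g (w (x / t))) p)"
      using \<open>0 < R\<close> by (intro locally_integrable_scaleR_compact_support[OF loc(2) _ K] continuous_intros
          cutoff_product_support) auto
    ultimately have "set_integrable lborel half_plane (\<lambda>p. F (fst p) (snd p))"
      unfolding F_def by (simp add: case_prod_unfold)
    then show ?thesis
      by (simp add: set_integrable_def lborel_prod case_prod_unfold)
  qed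

  define b where "b = (LINT t:{0..1}|lborel. cutoff 0 t)"
  have b: "has_bochner_integral lborel (\<lambda>t. indicator {0..1} t *\<^sub>R cutoff 0 t) b"
    unfolding b_def set_lebesgue_integral_def
    by (intro has_bochner_integral_integrable borel_integrable_compact continuous_intros compact_Icc)
  have b': "has_bochner_integral lborel (\<lambda>t. indicator {0..1} t *\<^sub>R cutoff_deriv 0 t) (cutoff 0 1 - cutoff 0 0)"
    using DERIV_cutoff[of 0]
    by (intro has_bochner_integral_FTC_Icc)
      (auto simp: has_real_derivative_iff_has_vector_derivative intro!: continuous_intros
        intro: has_vector_derivative_at_within)
  \<comment> \<open>The derivative of \<open>t \<beta>(t)\<close>, which performs the integration by parts.\<close>
  have tb': "has_bochner_integral lborel
      (\<lambda>t. indicator {0..1} t *\<^sub>R (cutoff 0 t + t * cutoff_deriv 0 t)) (1 * cutoff 0 1 - 0 * cutoff 0 0)"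
    by (intro has_bochner_integral_FTC_Icc)
      (auto simp flip: has_real_derivative_iff_has_vector_derivative intro!: continuous_intros derivative_eq_intros
        intro: DERIV_subset[OF DERIV_cutoff])
  have "has_bochner_integral lborel
      (\<lambda>t. (indicator {0..1} t *\<^sub>R cutoff_deriv 0 t) *\<^sub>R P +
        (indicator {0..1} t *\<^sub>R (cutoff 0 t + t * cutoff_deriv 0 t)) *\<^sub>R D +
        (indicator {0..1} t *\<^sub>R cutoff 0 t) *\<^sub>R (g vL - g vR - D))
      ((cutoff 0 1 - cutoff 0 0) *\<^sub>R P + (1 * cutoff 0 1 - 0 * cutoff 0 0) *\<^sub>R D + b *\<^sub>R (g vL - g vR - D))"
    by (intro has_bochner_integral_add has_bochner_integral_scaleR_left b b' tb')
  also have "(cutoff 0 1 - cutoff 0 0) *\<^sub>R P + (1 * cutoff 0 1 - 0 * cutoff 0 0) *\<^sub>R D +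
      b *\<^sub>R (g vL - g vR - D) = b *\<^sub>R (g vL - g vR - D) - P"
    by (simp add: cutoff_plateau cutoff_support)
  finally have outer: "(\<integral>t. (indicator {0..1} t *\<^sub>R cutoff_deriv 0 t) *\<^sub>R P +
        (indicator {0..1} t *\<^sub>R (cutoff 0 t + t * cutoff_deriv 0 t)) *\<^sub>R D +
        (indicator {0..1} t *\<^sub>R cutoff 0 t) *\<^sub>R (g vL - g vR - D) \<partial>lborel) =
      b *\<^sub>R (g vL - g vR - D) - P"
    by (rule has_bochner_integral_integral_eq)

  have "(LINT p:half_plane|lborel. F (fst p) (snd p)) =
      integral\<^sup>L (lborel \<Otimes>\<^sub>M lborel) (\<lambda>(x, t). indicator half_plane (x, t) *\<^sub>R F x t)"
    by (simp add: set_lebesgue_integral_def lborel_prod case_prod_unfold)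
  also have "\<dots> = (\<integral>t. (\<integral>x. indicator half_plane (x, t) *\<^sub>R F x t \<partial>lborel) \<partial>lborel)"
    by (rule lborel_pair.integral_snd[OF int, symmetric])
  also have "\<dots> = (\<integral>t. (indicator {0..1} t *\<^sub>R cutoff_deriv 0 t) *\<^sub>R P +
        (indicator {0..1} t *\<^sub>R (cutoff 0 t + t * cutoff_deriv 0 t)) *\<^sub>R D +
        (indicator {0..1} t *\<^sub>R cutoff 0 t) *\<^sub>R (g vL - g vR - D) \<partial>lborel)"
  \<comment> \<open>At \<open>t = 0\<close>, which the open half plane omits, the two integrands differ.\<close>
  proof (rule integral_discrete_difference[of "{0}"])
    fix t :: real
    assume "t \<notin> {0}"
    then consider "t < 0" | "0 < t" "t \<le> 1" | "1 < t" by force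
    then show "(\<integral>x. indicator half_plane (x, t) *\<^sub>R F x t \<partial>lborel) =
      (indicator {0..1} t *\<^sub>R cutoff_deriv 0 t) *\<^sub>R P +
        (indicator {0..1} t *\<^sub>R (cutoff 0 t + t * cutoff_deriv 0 t)) *\<^sub>R D +
        (indicator {0..1} t *\<^sub>R cutoff 0 t) *\<^sub>R (g vL - g vR - D)"
    proof cases
      case 1
      then show ?thesis by (simp add: half_plane_def)
    next
      case 2
      then show ?thesis
        using has_bochner_integral_integral_eq[OF slice[OF 2]]
        by (simp add: half_plane_def algebra_simps)
    next
      case 3
      then show ?thesis by (simp add: F_def cutoff_support)
    qed
  qed auto
  finally have F: "(LINT p:half_plane|lborel. F (fst p) (snd p)) = b *\<^sub>R (g vL - g vR - D) - P"
    using outer by simp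

  have "(LINT p:half_plane|lborel. F (fst p) (snd p)) +
      (LINT x|lborel. (cutoff R x * cutoff 0 0) *\<^sub>R u0 x) = 0"
    using weak[unfolded weak_solution_def, THEN conjunct2, THEN conjunct2, THEN conjunct2,
        rule_format, OF test_function_cutoff[of R 0]] \<open>0 < R\<close>
    by (simp add: case_prod_unfold F_def u0_def add.commute)
  then have "b *\<^sub>R (g vL - g vR - D) = 0"
    unfolding F by (simp add: cutoff_plateau P_def)
  then have "D = g vL - g vR"
    unfolding b_def integral_cutoff_0 by simp
  with e show ?thesis
    by (simp add: e_def u0_def)
qed

text \<open>
  At time \<open>t\<close> the unit cell is the interval \<open>[-R, R]\<close> in the variable \<open>\<xi> = x/t\<close>, where \<open>R = 1/(2t)\<close>, and
  \<open>R\<close> bounds the wave speeds. Using \<open>R\<close> in place of \<open>lmax n vL vR\<close> also covers maximum wave speeds that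
  are not positive.
\<close>

lemma riemann_average_eq:
  fixes f :: "real^'m \<Rightarrow> real^'d^'m"
  assumes sys: "hyperbolic_system A f E v lmax" and A: "vL \<in> A" "vR \<in> A" and n: "norm n = 1"
    and t: "0 < t" "t * lmax n vL vR \<le> 1 / 2"
  shows "riemann_average v t n vL vR = (1 / 2) *\<^sub>R (vL + vR) - t *\<^sub>R (f vR *v n - f vL *v n)"
proof -
  define R where "R = 1 / (2 * t)"
  let ?w = "v n vL vR"
  have "0 < R" and R: "lmax n vL vR \<le> R"
    using t by (auto simp: R_def field_simps)
  have left: "?w \<xi> = vL" if "\<xi> \<le> - R" for \<xi>
    using sys A n that R by (auto simp: hyperbolic_system_def)
  have right: "?w \<xi> = vR" if "R \<le> \<xi>" for \<xi>
    using sys A n that R by (auto simp: hyperbolic_system_def)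
  have "weak_solution A (\<lambda>U. f U *v n) (riemann_data vL vR) (\<lambda>(x, t). ?w (x / t))"
    using sys A n by (auto simp: hyperbolic_system_def riemann_solution_def)
  then have "has_bochner_integral lborel (\<lambda>\<xi>. ?w \<xi> - riemann_data vL vR \<xi>) (f vL *v n - f vR *v n)"
    using \<open>0 < R\<close> left right by (rule has_bochner_integral_self_similar_deviation)
  then have "has_bochner_integral lborel
      (\<lambda>\<xi>. (?w \<xi> - riemann_data vL vR \<xi>) + indicator {-R..R} \<xi> *\<^sub>R riemann_data vL vR \<xi>)
      ((f vL *v n - f vR *v n) + R *\<^sub>R (vL + vR))"
    using \<open>0 < R\<close> by (intro has_bochner_integral_add has_bochner_integral_riemann_data_Icc) auto
  also have "(\<lambda>\<xi>. (?w \<xi> - riemann_data vL vR \<xi>) + indicator {-R..R} \<xi> *\<^sub>R riemann_data vL vR \<xi>) =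
      (\<lambda>\<xi>. indicator {-R..R} \<xi> *\<^sub>R ?w \<xi>)"
    using \<open>0 < R\<close> left right by (auto simp: fun_eq_iff riemann_data_def split: split_indicator)
  finally have "has_bochner_integral lborel
      (\<lambda>x. indicator {-R..R} (0 + (1 / t) * x) *\<^sub>R ?w (0 + (1 / t) * x))
      (((f vL *v n - f vR *v n) + R *\<^sub>R (vL + vR)) /\<^sub>R \<bar>1 / t\<bar>)"
    using t by (subst lborel_has_bochner_integral_real_affine_iff[symmetric]) auto
  also have "(\<lambda>x. indicator {-R..R} (0 + (1 / t) * x) *\<^sub>R ?w (0 + (1 / t) * x)) =
      (\<lambda>x. indicator {-1/2..1/2} x *\<^sub>R ?w (x / t))"
    using t by (auto simp: fun_eq_iff R_def field_simps split: split_indicator)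
  finally have "riemann_average v t n vL vR =
      ((f vL *v n - f vR *v n) + R *\<^sub>R (vL + vR)) /\<^sub>R \<bar>1 / t\<bar>"
    unfolding riemann_average_def set_lebesgue_integral_def
    by (rule has_bochner_integral_integral_eq)
  then show ?thesis
    using t by (simp add: R_def algebra_simps)
qed

text \<open>
  The auxiliary state is the average over the fan of the Riemann problem in direction \<open>c i j\<close> at the time
  \<open>t = norm (c i j) / (2 * d)\<close>. The bound \<open>t * lmax \<le> 1/2\<close> says that \<open>d\<close> is at least
  \<open>lmax * norm (c i j)\<close>. Positivity of the viscosity and antisymmetry of \<open>c\<close> exclude \<open>c i j = 0\<close>, for which
  there would be no direction.
\<close>

lemma auxiliary_state_in_invariant_set:
  fixes f :: "real^'m \<Rightarrow> real^'d^'m"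
  assumes sys: "hyperbolic_system A f E v lmax" and inv: "invariant_set A S v lmax B \<tau>0"
    and B: "U i \<in> B" "U j \<in> B" and pos: "j \<noteq> i \<Longrightarrow> 0 < graph_viscosity I lmax c U i j"
    and antisym: "c i j = - c j i"
  shows "auxiliary_state I lmax c f U i j \<in> B"
proof (cases "j = i")
  case True
  then show ?thesis using B by (simp add: auxiliary_state_def)
next
  case False
  define d where "d = graph_viscosity I lmax c U i j"
  define t where "t = norm (c i j) / (2 * d)"
  have d: "0 < d" "d = viscosity_offdiag lmax c U i j"
    using False pos by (auto simp: d_def graph_viscosity_def)
  have c: "0 < norm (c i j)"
  proof (rule ccontr)
    assume "\<not> 0 < norm (c i j)"
    then have "d = 0" using antisym by (simp add: d viscosity_offdiag_def)
    with d show False by simp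
  qed
  then have unit: "norm (unit_normal c i j) = 1"
    by (simp add: unit_normal_def)
  have "lmax (unit_normal c i j) (U i) (U j) * norm (c i j) \<le> d"
    by (simp add: d viscosity_offdiag_def)
  then have t: "0 < t" "t * lmax (unit_normal c i j) (U i) (U j) \<le> 1 / 2"
    using d(1) c by (auto simp: t_def field_simps)
  have A: "U i \<in> A" "U j \<in> A"
    using inv B by (auto simp: invariant_set_def)
  have "t *\<^sub>R unit_normal c i j = c i j /\<^sub>R (2 * d)"
    using c by (simp add: t_def unit_normal_def field_simps)
  then have "(f (U j) - f (U i)) *v (c i j /\<^sub>R (2 * d)) =
      t *\<^sub>R (f (U j) *v unit_normal c i j - f (U i) *v unit_normal c i j)"
    by (metis matrix_vector_mult_diff_rdistrib matrix_vector_mult_scaleR)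
  then have "auxiliary_state I lmax c f U i j = riemann_average v t (unit_normal c i j) (U i) (U j)"
    using False by (simp add: auxiliary_state_def riemann_average_eq[OF sys A unit t] flip: d_def)
  also have "\<dots> \<in> B"
    using inv B unit t by (auto simp: invariant_set_def)
  finally show ?thesis .
qed

section \<open>The low-order update as a convex combination\<close>

lemma quasiconcave_on_convex_combination:
  assumes "convex B" "quasiconcave_on B \<Psi>" "finite J" "\<And>j. j \<in> J \<Longrightarrow> 0 \<le> a j" "sum a J = 1"
    "\<And>j. j \<in> J \<Longrightarrow> y j \<in> B" "\<And>j. j \<in> J \<Longrightarrow> \<kappa> \<le> \<Psi> (y j)"
  shows "(\<Sum>j\<in>J. a j *\<^sub>R y j) \<in> B \<and> \<kappa> \<le> \<Psi> (\<Sum>j\<in>J. a j *\<^sub>R y j)"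
proof -
  have "(\<Sum>j\<in>J. a j *\<^sub>R y j) \<in> {U \<in> B. \<kappa> \<le> \<Psi> U}"
    using assms by (intro convex_sum) (auto simp: quasiconcave_on_def)
  then show ?thesis by simp
qed

text \<open>
  Since the \<open>c i j\<close> sum to zero over the stencil, each flux \<open>f (U j)\<close> may be replaced by
  \<open>f (U j) - f (U i)\<close>. By its definition, the auxiliary state then collects the flux and the viscous
  contribution of \<open>j\<close>, at the price of a multiple of \<open>U i\<close>. Half of \<open>U i\<close> is kept apart for the source.
\<close>

lemma low_order_update_convex_combination:
  fixes f :: "real^'m \<Rightarrow> real^'d^'m"
  assumes st: "stencil V I m c" and "0 < \<Delta>t" and i: "i \<in> V"
    and pos: "\<And>j. j \<in> I i - {i} \<Longrightarrow> 0 < graph_viscosity I lmax c U i j"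
    and upd: "low_order_update V I m c f S lmax \<Delta>t U UL"
  shows "UL i = (1 / 2) *\<^sub>R (U i + (2 * \<Delta>t) *\<^sub>R S (U i)) +
    (1 / 2 + 2 * \<Delta>t * graph_viscosity I lmax c U i i / m i) *\<^sub>R U i +
    (\<Sum>j\<in>I i - {i}. (2 * \<Delta>t * graph_viscosity I lmax c U i j / m i) *\<^sub>R
      auxiliary_state I lmax c f U i j)"
proof -
  define d where "d = graph_viscosity I lmax c U i"
  define a where "a = \<Delta>t / m i"
  let ?J = "I i - {i}"
  have m: "0 < m i" and "finite (I i)" and iI: "i \<in> I i" and c0: "(\<Sum>j\<in>I i. c i j) = 0"
    using st i by (auto simp: stencil_def intro: finite_subset)
  have dii: "d i = - sum d ?J"
    by (auto simp: d_def graph_viscosity_def intro!: sum.cong)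
  have "(\<Sum>j\<in>I i. f (U j) *v c i j) = (\<Sum>j\<in>I i. f (U j) *v c i j) - f (U i) *v (\<Sum>j\<in>I i. c i j)"
    by (simp add: c0)
  also have "\<dots> = (\<Sum>j\<in>I i. (f (U j) - f (U i)) *v c i j)"
    by (simp add: sum_subtractf matrix_vector_mult_diff_rdistrib linear_sum[OF matrix_vector_mul_linear])
  also have "\<dots> = (\<Sum>j\<in>?J. (f (U j) - f (U i)) *v c i j)"
    using \<open>finite (I i)\<close> iI by (simp add: sum.remove[of "I i" i])
  finally have flux: "(\<Sum>j\<in>I i. f (U j) *v c i j) = (\<Sum>j\<in>?J. (f (U j) - f (U i)) *v c i j)" .
  have bar: "d j *\<^sub>R (U j - U i) - (f (U j) - f (U i)) *v c i j =
      (2 * d j) *\<^sub>R auxiliary_state I lmax c f U i j - (2 * d j) *\<^sub>R U i" if "j \<in> ?J" for j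
  proof -
    have "(2 * d j) *\<^sub>R auxiliary_state I lmax c f U i j =
        d j *\<^sub>R (U i + U j) - (f (U j) - f (U i)) *v c i j"
      using that pos[OF that]
      by (simp add: auxiliary_state_def scaleR_diff_right matrix_vector_mult_scaleR flip: d_def)
    moreover have "(2 * d j) *\<^sub>R U i = d j *\<^sub>R U i + d j *\<^sub>R U i"
      by (simp flip: scaleR_add_left)
    ultimately show ?thesis
      by (simp add: scaleR_add_right scaleR_diff_right)
  qed
  have "(m i / \<Delta>t) *\<^sub>R (UL i - U i) = m i *\<^sub>R S (U i) +
      ((\<Sum>j\<in>?J. d j *\<^sub>R (U j - U i)) - (\<Sum>j\<in>I i. f (U j) *v c i j))"
    using upd i by (simp add: low_order_update_def d_def algebra_simps)
  also have "(\<Sum>j\<in>?J. d j *\<^sub>R (U j - U i)) - (\<Sum>j\<in>I i. f (U j) *v c i j) =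
      (\<Sum>j\<in>?J. (2 * d j) *\<^sub>R auxiliary_state I lmax c f U i j - (2 * d j) *\<^sub>R U i)"
    unfolding flux sum_subtractf[symmetric] by (intro sum.cong refl bar)
  also have "\<dots> = (\<Sum>j\<in>?J. (2 * d j) *\<^sub>R auxiliary_state I lmax c f U i j) + (2 * d i) *\<^sub>R U i"
    by (simp add: sum_subtractf dii scaleR_sum_left sum_distrib_left flip: scaleR_sum_left)
  finally have eq: "(m i / \<Delta>t) *\<^sub>R (UL i - U i) = m i *\<^sub>R S (U i) +
      ((\<Sum>j\<in>?J. (2 * d j) *\<^sub>R auxiliary_state I lmax c f U i j) + (2 * d i) *\<^sub>R U i)" .
  have "UL i - U i = a *\<^sub>R ((m i / \<Delta>t) *\<^sub>R (UL i - U i))"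
    using m \<open>0 < \<Delta>t\<close> by (simp add: a_def)
  also have "\<dots> = \<Delta>t *\<^sub>R S (U i) + (\<Sum>j\<in>?J. (2 * a * d j) *\<^sub>R auxiliary_state I lmax c f U i j) +
      (2 * a * d i) *\<^sub>R U i"
    unfolding eq using m by (simp add: scaleR_add_right scaleR_sum_right a_def mult_ac)
  finally have "UL i = U i + \<Delta>t *\<^sub>R S (U i) + (2 * a * d i) *\<^sub>R U i +
      (\<Sum>j\<in>?J. (2 * a * d j) *\<^sub>R auxiliary_state I lmax c f U i j)"
    by (simp add: algebra_simps)
  moreover have "(1 / 2) *\<^sub>R U i + (1 / 2) *\<^sub>R U i = U i"
    by (simp flip: scaleR_add_left)
  ultimately show ?thesis
    by (simp add: a_def d_def scaleR_add_left scaleR_add_right mult_ac)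
qed

theorem lemma7p15:
  fixes A B :: "(real^'m) set"
    and f :: "real^'m \<Rightarrow> real^'d^'m"
    and S :: "real^'m \<Rightarrow> real^'m"
    and E :: "((real^'m \<Rightarrow> real) \<times> (real^'m \<Rightarrow> real^'d)) set"
    and v :: "real^'d \<Rightarrow> real^'m \<Rightarrow> real^'m \<Rightarrow> real \<Rightarrow> real^'m"
    and lmax :: "real^'d \<Rightarrow> real^'m \<Rightarrow> real^'m \<Rightarrow> real"
    and \<tau>0 \<Delta>t :: real
    and \<Psi> :: "real^'m \<Rightarrow> real"
    and V :: "'i set" and I :: "'i \<Rightarrow> 'i set" and m :: "'i \<Rightarrow> real"
    and c :: "'i \<Rightarrow> 'i \<Rightarrow> real^'d"
    and U UL :: "nat \<Rightarrow> 'i \<Rightarrow> real^'m"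
    and n :: nat and i :: 'i
  assumes "hyperbolic_system A f E v lmax"
    and "stencil V I m c"
    and "0 < \<Delta>t"
    and "\<forall>j\<in>V. U n j \<in> A"
    and "\<forall>j\<in>V. \<forall>k\<in>I j - {j}. 0 < graph_viscosity I lmax c (U n) j k"
    and "low_order_update V I m c f S lmax \<Delta>t (U n) (UL (Suc n))"
    and "invariant_set A S v lmax B \<tau>0"
    and "quasiconcave_on B \<Psi>"
    and "i \<in> V"
    and "0 \<le> 1 + 4 * \<Delta>t * (graph_viscosity I lmax c (U n) i i / m i)"
    and "2 * \<Delta>t \<le> \<tau>0"
    and "\<forall>j\<in>I i. U n j \<in> B"
  shows "UL (Suc n) i \<in> B \<and>
    min (\<Psi> (U n i + (2 * \<Delta>t) *\<^sub>R S (U n i)))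
        (Min ((\<lambda>j. \<Psi> (auxiliary_state I lmax c f (U n) i j)) ` I i)) \<le> \<Psi> (UL (Suc n) i)"
proof -
  let ?d = "graph_viscosity I lmax c (U n)" and ?Ubar = "auxiliary_state I lmax c f (U n) i"
  let ?W = "U n i + (2 * \<Delta>t) *\<^sub>R S (U n i)"
  define \<kappa> where "\<kappa> = min (\<Psi> ?W) (Min ((\<lambda>j. \<Psi> (?Ubar j)) ` I i))"
  have m: "0 < m i" and fin: "finite (I i)" and iI: "i \<in> I i" and "I i \<subseteq> V"
    and antisym: "\<And>j. j \<in> I i \<Longrightarrow> c i j = - c j i"
    using assms(2,9) by (auto simp: stencil_def intro: finite_subset)
  have pos: "0 < ?d i j" if "j \<in> I i - {i}" for j
    using assms(5,9) that by blast
  have dii: "?d i i = - (\<Sum>j\<in>I i - {i}. ?d i j)"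
    by (auto simp: graph_viscosity_def intro!: sum.cong)
  have convex: "convex B"
    using assms(7) by (simp add: invariant_set_def)
  have W: "?W \<in> B"
    using assms(3,7,11,12) iI by (auto simp: invariant_set_def)
  have bar: "?Ubar j \<in> B" if "j \<in> I i" for j
    using that assms(12) iI pos
    by (intro auxiliary_state_in_invariant_set[OF assms(1,7)] antisym) auto
  have \<kappa>_bar: "\<kappa> \<le> \<Psi> (?Ubar j)" if "j \<in> I i" for j
    unfolding \<kappa>_def using that fin by (intro min.coboundedI2 Min_le) auto
  \<comment> \<open>Twice the weights of the update, because \<open>Z\<close> itself enters with the factor \<open>1/2\<close>.\<close>
  define a where "a j = (if j = i then 1 + 4 * \<Delta>t * (?d i i / m i) else 4 * \<Delta>t * (?d i j / m i))" for j
  define Z where "Z = (\<Sum>j\<in>I i. a j *\<^sub>R ?Ubar j)"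
  have "(\<Sum>j\<in>I i - {i}. a j) = (4 * \<Delta>t / m i) * (\<Sum>j\<in>I i - {i}. ?d i j)"
    unfolding sum_distrib_left by (intro sum.cong) (auto simp: a_def)
  then have "sum a (I i) = 1"
    using fin iI by (simp add: sum.remove[of "I i" i] a_def dii)
  moreover have "0 \<le> a j" if "j \<in> I i" for j
    using that pos[of j] assms(3,10) m by (auto simp: a_def)
  ultimately have Z: "Z \<in> B \<and> \<kappa> \<le> \<Psi> Z"
    unfolding Z_def using fin bar \<kappa>_bar
    by (intro quasiconcave_on_convex_combination[OF convex assms(8)]) auto
  have "UL (Suc n) i = (1 / 2) *\<^sub>R ?W + (1 / 2 + 2 * \<Delta>t * ?d i i / m i) *\<^sub>R U n i +
      (\<Sum>j\<in>I i - {i}. (2 * \<Delta>t * ?d i j / m i) *\<^sub>R ?Ubar j)"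
    by (rule low_order_update_convex_combination[OF assms(2,3,9) pos assms(6)])
  also have "(\<Sum>j\<in>I i - {i}. (2 * \<Delta>t * ?d i j / m i) *\<^sub>R ?Ubar j) =
      (1 / 2) *\<^sub>R (\<Sum>j\<in>I i - {i}. a j *\<^sub>R ?Ubar j)"
    unfolding scaleR_sum_right by (intro sum.cong) (auto simp: a_def)
  also have "(1 / 2) *\<^sub>R ?W + (1 / 2 + 2 * \<Delta>t * ?d i i / m i) *\<^sub>R U n i + \<dots> =
      (1 / 2) *\<^sub>R ?W + (1 / 2) *\<^sub>R Z"
    using fin iI by (simp add: Z_def sum.remove[of "I i" i] a_def auxiliary_state_def
        scaleR_add_right scaleR_add_left)
  finally have "UL (Suc n) i = (\<Sum>b\<in>UNIV. (1 / 2) *\<^sub>R (if b then ?W else Z))"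
    by (simp add: UNIV_bool add.commute)
  moreover have "\<kappa> \<le> \<Psi> ?W"
    by (simp add: \<kappa>_def)
  ultimately show ?thesis
    using quasiconcave_on_convex_combination[OF convex assms(8), of UNIV "\<lambda>_. 1 / 2"
        "\<lambda>b. if b then ?W else Z" \<kappa>] W Z
    by (simp add: UNIV_bool flip: \<kappa>_def)
qed

end
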